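(* For $n\in\mathbb{N}_0$ let $z(n)$ be the number of integers $k\ge0$ such that $\binom{(n)_2}{(k)_2}\neq0$, and let $Z(N)=\sum_{0\le n<N}z(n)$. Let $\kappa=\log_23$, $\varphi=\frac{1+\sqrt5}2$, let $d$ be Stern's diatomic sequence and $\Phi_D$ the unique $1$-periodic continuous function with $\sum_{0\le n<N}d(n)=N^\kappa\Phi_D(\{\log_2N\})+O(N^{\log_2\varphi})$ as $N\to\infty$. Then for all $N\ge1$, \[Z(N)=N^\kappa\,\Phi_Z(\{\log_2N\})\qquad\text{with }\Phi_Z=2\Phi_D.\]
   Context: $(n)_2$ is the binary expansion of $n$ as a word over $\{0,1\}$ (with $(0)_2$ the empty word). For words $u=u_1\dots u_j$, $w=w_1\dots w_k$, the binomial coefficient $\binom{u}{w}$ is the number of strictly increasing maps $\pi\colon\{1,\dots,k\}\to\{1,\dots,j\}$ with $u_{\pi(i)}=w_i$ for all $i$ (occurrences of $w$ as a scattered subword of $u$). Stern's diatomic sequence: $d(0)=0$, $d(1)=1$, $d(2n)=d(n)$, $d(2n+1)=d(n)+d(n+1)$ for $n\ge0$. $\{z\}=z-\lfloor z\rfloor$. *)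

theory Defs
  imports Complex_Main "HOL-Library.FuncSet" "HOL-Library.Landau_Symbols"
begin

text \<open>Binary expansion, most significant digit first; zero is sent to the empty word.\<close>

fun bin :: "nat \<Rightarrow> nat list" where
  "bin n = (if n = 0 then [] else bin (n div 2) @ [n mod 2])"

declare bin.simps [simp del]

text \<open>Positions are numbered from \<open>0\<close> as usual for lists. The extensional function space
  \<open>\<rightarrow>\<^sub>E\<close> makes the strictly increasing maps on the finite index set countable by \<open>card\<close>.\<close>

definition word_binomial :: "'a list \<Rightarrow> 'a list \<Rightarrow> nat" where
  "word_binomial u w =
     card {\<pi> \<in> {..<length w} \<rightarrow>\<^sub>E {..<length u}.
             strict_mono_on {..<length w} \<pi> \<and> (\<forall>i<length w. u ! \<pi> i = w ! i)}"

definition z :: "nat \<Rightarrow> nat" where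
  "z n = card {k. word_binomial (bin n) (bin k) \<noteq> 0}"

definition Z :: "nat \<Rightarrow> nat" where
  "Z N = (\<Sum>n<N. z n)"

function stern :: "nat \<Rightarrow> nat" where
  "stern n = (if n = 0 then 0 else if n = 1 then 1
     else if even n then stern (n div 2)
     else stern (n div 2) + stern (n div 2 + 1))"
  by pat_completeness auto
termination
proof (relation "measure id")
  fix n :: nat
  assume "n \<noteq> 0" "n \<noteq> 1" "odd n"
  then show "(n div 2 + 1, n) \<in> measure id"
    by (auto elim!: oddE)
qed auto

declare stern.simps [simp del]

lemma stern_0: "stern 0 = 0"
  and stern_1: "stern 1 = 1"
  by (simp_all add: stern.simps)

lemma stern_even: "stern (2 * n) = stern n"
  by (cases "n = 0") (simp_all add: stern.simps [of "2 * n"] stern_0)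

lemma stern_odd: "stern (2 * n + 1) = stern n + stern (n + 1)"
  by (cases "n = 0") (simp_all add: stern.simps [of "Suc (2 * n)"] stern_0 stern_1 [simplified])

definition \<kappa> :: real where
  "\<kappa> = log 2 3"

definition \<phi> :: real where
  "\<phi> = (1 + sqrt 5) / 2"

definition is_Phi_D :: "(real \<Rightarrow> real) \<Rightarrow> bool" where
  "is_Phi_D \<Phi> \<longleftrightarrow>
     continuous_on UNIV \<Phi> \<and> (\<forall>x. \<Phi> (x + 1) = \<Phi> x) \<and>
     (\<lambda>N::nat. real (\<Sum>n<N. stern n) - real N powr \<kappa> * \<Phi> (frac (log 2 (real N))))
       \<in> O(\<lambda>N. real N powr log 2 \<phi>)"

definition Phi_D :: "real \<Rightarrow> real" where
  "Phi_D = (THE \<Phi>. is_Phi_D \<Phi>)"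

definition Phi_Z :: "real \<Rightarrow> real" where
  "Phi_Z x = 2 * Phi_D x"

end

theory Submission imports Defs begin

text \<open>Appending a binary digit to \<open>n\<close> and sorting the scattered subwords by their last letter gives
  \<open>z n = d n + d (n + 1) = d (2 n + 1)\<close>. Hence \<open>z (2 n) + z (2 n + 1) = 3 z n\<close>, so that
  \<open>Z (2 N) = 3 Z N\<close> holds exactly, while \<open>Z N = 2 D N + d N\<close> with \<open>D\<close> the summatory function of
  \<open>d\<close> and \<open>d N = O(N powr log 2 \<phi>)\<close>. The exact functional equation extends \<open>Z\<close> from the integers
  to a function \<open>F\<close> on \<open>[0, \<infinity>)\<close> with \<open>F (2 x) = 3 F x\<close>, which is continuous because
  \<open>d n / 3\<^sup>k\<close> tends to \<open>0\<close> uniformly for \<open>n = O(2\<^sup>k)\<close>. Then \<open>\<Phi> t = F (2\<^sup>t) / (2 \<cdot> 3\<^sup>t)\<close>.\<close>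

section \<open>Scattered subwords\<close>

text \<open>Maps need not be extensional here, so witnesses can be restricted or updated freely;
  \<open>restrict\<close> returns to the counted set.\<close>

definition embeds :: "'a list \<Rightarrow> 'a list \<Rightarrow> bool" where
  "embeds w u \<longleftrightarrow>
     (\<exists>\<pi>. strict_mono_on {..<length w} \<pi> \<and> (\<forall>i<length w. \<pi> i < length u \<and> u ! \<pi> i = w ! i))"

lemma word_binomial_nonzero_iff: "word_binomial u w \<noteq> 0 \<longleftrightarrow> embeds w u"
proof -
  let ?S = "{\<pi> \<in> {..<length w} \<rightarrow>\<^sub>E {..<length u}.
             strict_mono_on {..<length w} \<pi> \<and> (\<forall>i<length w. u ! \<pi> i = w ! i)}"
  have "finite ?S" by (rule finite_subset[OF _ finite_PiE[of "{..<length w}" "\<lambda>_. {..<length u}"]]) auto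
  then have "word_binomial u w \<noteq> 0 \<longleftrightarrow> ?S \<noteq> {}" by (simp add: word_binomial_def)
  also have "\<dots> \<longleftrightarrow> embeds w u"
  proof
    assume "?S \<noteq> {}"
    then obtain \<pi> where "\<pi> \<in> ?S" by blast
    then show "embeds w u" unfolding embeds_def by (intro exI[of _ \<pi>]) (auto simp: PiE_iff)
  next
    assume "embeds w u"
    then obtain \<pi> where "strict_mono_on {..<length w} \<pi>"
      "\<forall>i<length w. \<pi> i < length u \<and> u ! \<pi> i = w ! i" unfolding embeds_def by blast
    then have "restrict \<pi> {..<length w} \<in> ?S" by (auto simp: strict_mono_on_def)
    then show "?S \<noteq> {}" by blast
  qed
  finally show ?thesis .
qed

lemma embeds_Nil: "embeds [] u"
  by (simp add: embeds_def)

lemma embeds_Nil_right: "embeds w [] \<longleftrightarrow> w = []"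
  by (auto simp: embeds_def)

text \<open>Strict monotonicity puts all earlier letters before the image of the last one, hence
  inside \<open>u\<close>. Conversely the new letter goes to the new final position
  \<open>length u\<close>.\<close>

lemma embeds_snoc_same: "embeds (w @ [a]) (u @ [a]) \<longleftrightarrow> embeds w u"
proof
  assume "embeds (w @ [a]) (u @ [a])"
  then obtain \<pi> where m: "strict_mono_on {..<Suc (length w)} \<pi>"
    and e: "\<And>i. i < Suc (length w) \<Longrightarrow> \<pi> i < Suc (length u) \<and> (u @ [a]) ! \<pi> i = (w @ [a]) ! i"
    unfolding embeds_def by auto
  have l: "\<pi> i < length u" if "i < length w" for i
    using strict_mono_onD[OF m, of i "length w"] e[of "length w"] that by auto
  have "u ! \<pi> i = w ! i" if "i < length w" for i
    using e[of i] l[OF that] that by (simp add: nth_append)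
  with l m show "embeds w u" unfolding embeds_def
    by (intro exI[of _ \<pi>]) (auto simp: strict_mono_on_def)
next
  assume "embeds w u"
  then obtain \<pi> where "strict_mono_on {..<length w} \<pi>"
    "\<forall>i<length w. \<pi> i < length u \<and> u ! \<pi> i = w ! i" unfolding embeds_def by blast
  then show "embeds (w @ [a]) (u @ [a])" unfolding embeds_def
    by (intro exI[of _ "\<pi>(length w := length u)"])
      (auto simp: strict_mono_on_def nth_append less_Suc_eq)
qed

text \<open>The last letter \<open>a\<close> cannot sit on the final \<open>b\<close>, and then, by
  monotonicity, no letter can.\<close>

lemma embeds_snoc_different:
  assumes "a \<noteq> b"
  shows "embeds (w @ [a]) (u @ [b]) \<longleftrightarrow> embeds (w @ [a]) u"
proof
  assume "embeds (w @ [a]) (u @ [b])"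
  then obtain \<pi> where m: "strict_mono_on {..<Suc (length w)} \<pi>"
    and e: "\<And>i. i < Suc (length w) \<Longrightarrow> \<pi> i < Suc (length u) \<and> (u @ [b]) ! \<pi> i = (w @ [a]) ! i"
    unfolding embeds_def by auto
  have "\<pi> (length w) \<noteq> length u" using e[of "length w"] assms by auto
  then have last: "\<pi> (length w) < length u" using e[of "length w"] by auto
  have l: "\<pi> i < length u" if "i < Suc (length w)" for i
    using strict_mono_onD[OF m, of i "length w"] last that by (cases "i = length w") auto
  have "u ! \<pi> i = (w @ [a]) ! i" if "i < Suc (length w)" for i
    using e[of i] l[OF that] that by (simp add: nth_append[of u])
  with l m show "embeds (w @ [a]) u" unfolding embeds_def
    by (intro exI[of _ \<pi>]) auto
next
  assume "embeds (w @ [a]) u"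
  then show "embeds (w @ [a]) (u @ [b])" unfolding embeds_def
    by (auto simp: nth_append[of u] less_SucI)
qed

section \<open>Subword values sorted by parity\<close>

lemma bin_0: "bin 0 = []"
  by (simp add: bin.simps)

lemma bin_odd: "bin (2 * n + 1) = bin n @ [1]"
  by (subst bin.simps) simp

lemma bin_even: "n > 0 \<Longrightarrow> bin (2 * n) = bin n @ [0]"
  by (subst bin.simps) simp

definition subword_values :: "nat \<Rightarrow> nat set" where
  "subword_values n = {k. embeds (bin k) (bin n)}"

lemma subword_values_0: "subword_values 0 = {0}"
proof -
  have "bin k = [] \<longleftrightarrow> k = 0" for k by (subst bin.simps) simp
  then show ?thesis by (simp add: subword_values_def bin_0 embeds_Nil_right)
qed

lemma zero_in_subword_values: "0 \<in> subword_values n"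
  by (simp add: subword_values_def bin_0 embeds_Nil)

lemma odd_subword_values_odd:
  "{k \<in> subword_values (2 * n + 1). odd k} = (\<lambda>k. 2 * k + 1) ` subword_values n"
  by (auto simp: subword_values_def bin_odd[simplified] embeds_snoc_same elim!: oddE)

text \<open>A positive even value ends in the digit \<open>0\<close>, which cannot use the appended
  \<open>1\<close>. The value \<open>0\<close> has no last digit and is treated separately.\<close>

lemma even_subword_values_odd:
  "{k \<in> subword_values (2 * n + 1). even k} = {k \<in> subword_values n. even k}"
proof -
  have "2 * k \<in> subword_values (2 * n + 1) \<longleftrightarrow> 2 * k \<in> subword_values n" for k
    by (cases "k = 0") (simp_all add: zero_in_subword_values,
      simp add: subword_values_def bin_odd[simplified] bin_even embeds_snoc_different)
  then show ?thesis by (auto elim!: evenE)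
qed

lemma odd_subword_values_even:
  "{k \<in> subword_values (2 * n). odd k} = {k \<in> subword_values n. odd k}"
  by (cases "n = 0")
    (auto simp: subword_values_def bin_odd[simplified] bin_even embeds_snoc_different elim!: oddE)

lemma even_subword_values_even:
  "{k \<in> subword_values (2 * n). even k} = (\<lambda>k. 2 * k) ` subword_values n"
proof (cases "n = 0")
  case True
  then show ?thesis by (auto simp: subword_values_0)
next
  case False
  have "2 * k \<in> subword_values (2 * n) \<longleftrightarrow> k \<in> subword_values n" for k
    using False by (cases "k = 0") (simp_all add: zero_in_subword_values,
      simp add: subword_values_def bin_even embeds_snoc_same)
  then show ?thesis by (auto elim!: evenE)
qed

lemma card_split_parity:
  fixes A :: "nat set"
  assumes "finite A"
  shows "card A = card {k \<in> A. odd k} + card {k \<in> A. even k}"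
  using card_Int_Diff[OF assms, of "{k. odd k}"] by (simp add: Int_def set_diff_eq)

lemma finite_split_parity:
  fixes A :: "nat set"
  assumes "finite {k \<in> A. odd k}" "finite {k \<in> A. even k}"
  shows "finite A"
  by (rule finite_subset[OF _ finite_UnI[OF assms]]) auto

text \<open>Counting the parities separately closes the induction: an appended digit replaces the
  class of its own parity by a copy of the whole set and keeps the other class. This is Stern's
  recursion for the pair \<open>(stern n, stern (n + 1))\<close>.\<close>

lemma subword_values_card:
  "finite (subword_values n) \<and> card {k \<in> subword_values n. odd k} = stern n
     \<and> card {k \<in> subword_values n. even k} = stern (n + 1)"
proof (induction n rule: nat_bit_induct)
  case zero
  have "{k \<in> {0::nat}. odd k} = {}" "{k \<in> {0::nat}. even k} = {0}" by (auto simp: odd_pos)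
  then show ?case by (simp only: subword_values_0) (simp add: stern_0 stern_1[simplified])
next
  case (even n)
  have "finite (subword_values (2 * n))"
    by (rule finite_split_parity)
      (use even in \<open>simp_all only: odd_subword_values_even even_subword_values_even, auto\<close>)
  moreover have "card ((\<lambda>k. 2 * k) ` subword_values n) = stern n + stern (n + 1)"
    using even card_split_parity[of "subword_values n"] by (subst card_image) (auto simp: inj_on_def)
  ultimately show ?case
    using even stern_odd[of n]
    by (simp only: odd_subword_values_even even_subword_values_even stern_even)
next
  case (odd n)
  have "finite (subword_values (2 * n + 1))"
    by (rule finite_split_parity)
      (use odd in \<open>simp_all only: odd_subword_values_odd even_subword_values_odd, auto\<close>)
  moreover have "card ((\<lambda>k. 2 * k + 1) ` subword_values n) = stern n + stern (n + 1)"
    using odd card_split_parity[of "subword_values n"] by (subst card_image) (auto simp: inj_on_def)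
  moreover have "stern (2 * n + 1 + 1) = stern (n + 1)"
    using stern_even[of "n + 1"] by simp
  ultimately show ?case
    using odd stern_odd[of n]
    by (simp only: odd_subword_values_odd even_subword_values_odd Suc_eq_plus1)
qed

section \<open>Exact recursions for \<open>z\<close> and its sums\<close>

lemma z_eq: "z n = stern n + stern (n + 1)"
  using subword_values_card[of n] card_split_parity[of "subword_values n"]
  by (simp add: z_def word_binomial_nonzero_iff subword_values_def del: neq0_conv)

lemma z_eq_stern_odd: "z n = stern (2 * n + 1)"
  by (simp only: z_eq stern_odd)

lemma z_double: "z (2 * n) + z (2 * n + 1) = 3 * z n"
  using stern_even[of "n + 1"] stern_odd[of n] stern_even[of n] by (simp add: z_eq)

lemma Z_double: "Z (2 * N) = 3 * Z N"
proof (induction N)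
  case 0
  show ?case by (simp add: Z_def)
next
  case (Suc N)
  then show ?case using z_double[of N] by (simp add: Z_def)
qed

lemma Z_power: "Z (2 ^ k * N) = 3 ^ k * Z N"
  by (induction k) (simp_all add: Z_double mult.assoc)

lemma Z_mono: "M \<le> N \<Longrightarrow> Z M \<le> Z N"
  unfolding Z_def by (rule sum_mono2) auto

text \<open>Summing \<open>stern (n + 1)\<close> instead of \<open>stern n\<close> adds only the
  boundary term \<open>stern N\<close>, as \<open>stern 0 = 0\<close>. That term becomes the error
  term for \<open>Phi_D\<close>.\<close>

lemma Z_eq_sum_stern: "Z N = 2 * (\<Sum>n<N. stern n) + stern N"
  by (induction N) (simp_all add: Z_def z_eq stern_0)

section \<open>Growth of Stern's sequence\<close>

lemma phi_gt_1: "1 < \<phi>"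
  by (simp add: \<phi>_def)

lemma phi_lt_3: "\<phi> < 3"
proof -
  have "sqrt 5 < sqrt (25::real)" by (simp only: real_sqrt_less_iff)
  then show ?thesis by (simp add: \<phi>_def)
qed

lemma phi_square: "\<phi> ^ 2 = \<phi> + 1"
  by (simp add: \<phi>_def power2_eq_square field_simps)

text \<open>One of \<open>m\<close> and \<open>m + 1\<close> is even, so the odd case gains a second factor \<open>2\<close> in one of the two
  terms; this gives the Fibonacci recursion.\<close>

lemma stern_le_phi_power: "n \<le> 2 ^ k \<Longrightarrow> real (stern n) \<le> \<phi> ^ k"
proof (induction k arbitrary: n rule: less_induct)
  case (less k)
  consider "n \<le> 2" | m where "n = 2 * m" "m \<ge> 2" | m where "n = 2 * m + 1" "m \<ge> 1"
    by (cases "n \<le> 2"; cases "even n") (auto elim!: evenE oddE)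
  then show ?case
  proof cases
    case 1
    then have "stern n \<le> 1"
      using stern_0 stern_1 stern_even[of 1] by (auto simp: le_Suc_eq numeral_2_eq_2)
    moreover have "1 \<le> \<phi> ^ k" using phi_gt_1 by simp
    ultimately show ?thesis by linarith
  next
    case 2
    then obtain j where k: "k = Suc j" using less.prems by (cases k) auto
    have "real (stern m) \<le> \<phi> ^ j" using less.IH[of j m] less.prems 2 k by simp
    also have "\<dots> \<le> \<phi> ^ k" using phi_gt_1 k by simp
    finally show ?thesis by (simp add: 2 stern_even)
  next
    case 3
    \<comment> \<open>Here \<open>n \<ge> 3\<close> forces \<open>k \<ge> 2\<close>, so two levels
      of the induction hypothesis are available.\<close>
    then have "(2::nat) ^ 1 < 2 ^ k" using less.prems by simp
    then have "1 < k" by (subst (asm) power_strict_increasing_iff) simp_all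
    then obtain j where k: "k = Suc (Suc j)" using less_imp_Suc_add[of 1 k] by auto
    \<comment> \<open>As \<open>n\<close> is odd and \<open>2 ^ k\<close> is even, the bound covers
      \<open>n + 1 = 2 * (m + 1)\<close> as well.\<close>
    have m: "m + 1 \<le> 2 ^ Suc j" using less.prems 3 k by simp
    have half: "real (stern i) \<le> \<phi> ^ j" if "i \<le> 2 ^ Suc j" "even i" for i
      using that less.IH[of j "i div 2"] k by (auto simp: stern_even elim!: evenE)
    have full: "real (stern i) \<le> \<phi> ^ Suc j" if "i \<le> 2 ^ Suc j" for i
      using that less.IH[of "Suc j" i] k by simp
    have "real (stern m) + real (stern (m + 1)) \<le> \<phi> ^ j + \<phi> ^ Suc j"
      using half[of m] half[of "m + 1"] full[of m] full[of "m + 1"] m by (cases "even m") auto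
    also have "\<dots> = \<phi> ^ j * \<phi> ^ 2" unfolding phi_square by (simp add: algebra_simps)
    also have "\<dots> = \<phi> ^ k" by (simp add: k power2_eq_square)
    finally show ?thesis by (simp only: 3 stern_odd of_nat_add)
  qed
qed

lemma stern_bigo: "(\<lambda>N. real (stern N)) \<in> O(\<lambda>N. real N powr log 2 \<phi>)"
proof (rule bigoI[of _ \<phi>], rule eventually_sequentiallyI[of 1])
  fix N :: nat assume N: "1 \<le> N"
  \<comment> \<open>Then \<open>2 ^ k \<le> N < 2 ^ Suc k\<close>; rounding the exponent up costs
    one factor \<open>\<phi>\<close>, the constant given to \<open>bigoI\<close>.\<close>
  define k where "k = nat \<lfloor>log 2 (real N)\<rfloor>"
  have k: "real k \<le> log 2 (real N)" "log 2 (real N) < real (Suc k)"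
    using N unfolding k_def by (auto simp: of_nat_floor) linarith
  have "log 2 (real N) < log 2 (2 ^ Suc k)" using k(2) by (simp add: log_nat_power del: power_Suc)
  then have "real N < real (2 ^ Suc k)" using N by (subst (asm) log_less_cancel_iff) auto
  then have "N \<le> 2 ^ Suc k" by (simp only: of_nat_less_iff less_imp_le)
  then have "real (stern N) \<le> \<phi> ^ Suc k"
    by (rule stern_le_phi_power)
  also have "\<dots> = \<phi> * \<phi> powr real k" using phi_gt_1 by (simp add: powr_realpow)
  also have "\<dots> \<le> \<phi> * \<phi> powr log 2 (real N)" using k(1) phi_gt_1 by simp
  also have "\<phi> powr log 2 (real N) = real N powr log 2 \<phi>"
    using N phi_gt_1 by (simp add: powr_def log_def)
  finally show "norm (real (stern N)) \<le> \<phi> * norm (real N powr log 2 \<phi>)" by simp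
qed

section \<open>Extension of the summatory function to the half-line\<close>

text \<open>By \<open>Z_power\<close>, dividing by \<open>3 ^ k\<close> rescales \<open>Z\<close> to
  the grid of mesh \<open>1 / 2 ^ k\<close>. For \<open>x \<ge> 0\<close>, \<open>F_lower\<close>
  and \<open>F_upper\<close> sample it at the ends of the cell containing \<open>x\<close>.\<close>

definition F_lower :: "real \<Rightarrow> nat \<Rightarrow> real" where
  "F_lower x k = real (Z (nat \<lfloor>2 ^ k * x\<rfloor>)) / 3 ^ k"

definition F_upper :: "real \<Rightarrow> nat \<Rightarrow> real" where
  "F_upper x k = real (Z (nat \<lfloor>2 ^ k * x\<rfloor> + 1)) / 3 ^ k"

definition F :: "real \<Rightarrow> real" where
  "F x = lim (F_lower x)"

text \<open>Halving the mesh puts the new cell inside the old one; this makes both approximations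
  monotone in the level.\<close>

lemma floor_double_bounds:
  fixes y :: real
  assumes "0 \<le> y"
  shows "2 * nat \<lfloor>y\<rfloor> \<le> nat \<lfloor>2 * y\<rfloor>" "nat \<lfloor>2 * y\<rfloor> + 1 \<le> 2 * (nat \<lfloor>y\<rfloor> + 1)"
proof -
  have "2 * \<lfloor>y\<rfloor> \<le> \<lfloor>2 * y\<rfloor>" by linarith
  moreover have "\<lfloor>2 * y\<rfloor> < 2 * (\<lfloor>y\<rfloor> + 1)"
    unfolding floor_less_iff of_int_mult of_int_add of_int_1 of_int_numeral
    by (rule mult_strict_left_mono) simp_all
  moreover have "0 \<le> \<lfloor>y\<rfloor>" using assms by simp
  moreover have "2 * nat a \<le> nat b \<and> nat b + 1 \<le> 2 * (nat a + 1)"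
    if "2 * a \<le> b" "b < 2 * (a + 1)" "0 \<le> a" for a b :: int
    using that by auto
  ultimately show "2 * nat \<lfloor>y\<rfloor> \<le> nat \<lfloor>2 * y\<rfloor>" "nat \<lfloor>2 * y\<rfloor> + 1 \<le> 2 * (nat \<lfloor>y\<rfloor> + 1)"
    by blast+
qed

lemma F_lower_incseq:
  assumes "0 \<le> x"
  shows "incseq (F_lower x)"
proof (rule incseq_SucI)
  fix k
  have "3 * Z (nat \<lfloor>2 ^ k * x\<rfloor>) \<le> Z (nat \<lfloor>2 * (2 ^ k * x)\<rfloor>)"
    unfolding Z_double[symmetric] by (intro Z_mono floor_double_bounds) (use assms in simp)
  then have "3 * real (Z (nat \<lfloor>2 ^ k * x\<rfloor>)) \<le> real (Z (nat \<lfloor>2 * (2 ^ k * x)\<rfloor>))" by linarith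
  then show "F_lower x k \<le> F_lower x (Suc k)"
    by (simp add: F_lower_def field_simps)
qed

lemma F_upper_decseq:
  assumes "0 \<le> x"
  shows "decseq (F_upper x)"
proof (rule decseq_SucI)
  fix k
  have "Z (nat \<lfloor>2 * (2 ^ k * x)\<rfloor> + 1) \<le> 3 * Z (nat \<lfloor>2 ^ k * x\<rfloor> + 1)"
    unfolding Z_double[symmetric] by (intro Z_mono floor_double_bounds) (use assms in simp)
  then have "real (Z (nat \<lfloor>2 * (2 ^ k * x)\<rfloor> + 1)) \<le> 3 * real (Z (nat \<lfloor>2 ^ k * x\<rfloor> + 1))" by linarith
  then show "F_upper x (Suc k) \<le> F_upper x k"
    by (simp add: F_upper_def field_simps)
qed

text \<open>Different levels are compared at their common refinement \<open>max j k\<close>.\<close>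

lemma F_lower_le_F_upper:
  assumes "0 \<le> x"
  shows "F_lower x j \<le> F_upper x k"
proof -
  have "F_lower x j \<le> F_lower x (max j k)" using F_lower_incseq[OF assms] by (simp add: incseqD)
  also have "\<dots> \<le> F_upper x (max j k)"
    unfolding F_lower_def F_upper_def by (intro divide_right_mono) (simp_all add: Z_mono)
  also have "\<dots> \<le> F_upper x k" using F_upper_decseq[OF assms] by (simp add: decseqD)
  finally show ?thesis .
qed

lemma F_lower_tendsto:
  assumes "0 \<le> x"
  shows "F_lower x \<longlonglongrightarrow> F x"
proof -
  obtain L where "F_lower x \<longlonglongrightarrow> L"
    by (rule incseq_convergent[OF F_lower_incseq[OF assms] allI])
      (rule F_lower_le_F_upper[OF assms, of _ 0])
  then show ?thesis unfolding F_def by (simp add: limI)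
qed

lemma F_lower_le_F: "0 \<le> x \<Longrightarrow> F_lower x k \<le> F x"
  by (rule incseq_le[OF F_lower_incseq F_lower_tendsto])

lemma F_le_F_upper: "0 \<le> x \<Longrightarrow> F x \<le> F_upper x k"
  by (rule LIMSEQ_le_const2[OF F_lower_tendsto]) (auto intro: F_lower_le_F_upper)

section \<open>Functional equation and continuity of the extension\<close>

lemma F_double:
  assumes "0 \<le> x"
  shows "F (2 * x) = 3 * F x"
proof (rule LIMSEQ_unique[OF F_lower_tendsto])
  \<comment> \<open>Since \<open>2 ^ k * (2 * x) = 2 ^ Suc k * x\<close>, doubling \<open>x\<close>
    shifts the level by one.\<close>
  have "(\<lambda>k. 3 * F_lower x (Suc k)) \<longlonglongrightarrow> 3 * F x"
    by (intro tendsto_mult_left LIMSEQ_Suc F_lower_tendsto assms)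
  then show "F_lower (2 * x) \<longlonglongrightarrow> 3 * F x"
    by (simp add: F_lower_def[abs_def] mult.left_commute mult.assoc)
qed (use assms in simp)

lemma F_of_nat: "F (real N) = real (Z N)"
proof -
  have "nat \<lfloor>2 ^ k * real N\<rfloor> = 2 ^ k * N" for k
    by (metis floor_of_nat nat_int of_nat_mult of_nat_numeral of_nat_power)
  then have "F_lower (real N) = (\<lambda>_. real (Z N))"
    by (simp add: F_lower_def fun_eq_iff Z_power)
  then show ?thesis using F_lower_tendsto[of "real N"] by (simp add: LIMSEQ_const_iff)
qed

text \<open>Points at most one mesh apart have both values between \<open>Z m / 3 ^ k\<close> and
  \<open>Z (m + 2) / 3 ^ k\<close>. The gap consists of two Stern numbers of index at most
  \<open>2 * m + 3\<close>, and \<open>c\<close> is such that this index is at most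
  \<open>2 ^ (k + c)\<close>.\<close>

lemma F_modulus:
  assumes "0 \<le> x" "x \<le> y" "y \<le> x + 1 / 2 ^ k" "2 * x + 3 \<le> 2 ^ c"
  shows "\<bar>F x - F y\<bar> \<le> 2 * \<phi> ^ c * (\<phi> / 3) ^ k"
proof -
  define m where "m = nat \<lfloor>2 ^ k * x\<rfloor>"
  define m' where "m' = nat \<lfloor>2 ^ k * y\<rfloor>"
  have "2 ^ k * x \<le> 2 ^ k * y" "2 ^ k * y \<le> 2 ^ k * x + 1" "0 \<le> 2 ^ k * x"
    using assms by (simp_all add: field_simps)
  then have m: "m \<le> m'" "m' \<le> m + 1" "real m \<le> 2 ^ k * x"
    unfolding m_def m'_def by linarith+
  have one: "1 \<le> (2::real) ^ k" by simp
  have "2 * real m + 3 \<le> 2 ^ k * (2 * x + 3)"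
    using m(3) one by (simp only: distrib_left)
  also have "\<dots> \<le> 2 ^ k * 2 ^ c" using assms(4) by simp
  finally have le: "2 * m + 3 \<le> 2 ^ (k + c)"
    by (simp add: power_add flip: of_nat_le_iff[where 'a = real])
  have "real (Z (m + 2)) - real (Z m) = real (stern (2 * m + 1)) + real (stern (2 * (m + 1) + 1))"
    by (simp only: z_eq_stern_odd[symmetric]) (simp add: Z_def)
  also have "\<dots> \<le> \<phi> ^ (k + c) + \<phi> ^ (k + c)"
    by (intro add_mono stern_le_phi_power) (use le in auto)
  finally have gap: "(real (Z (m + 2)) - real (Z m)) / 3 ^ k \<le> 2 * \<phi> ^ c * (\<phi> / 3) ^ k"
    by (simp add: power_divide power_add divide_right_mono mult.commute mult.left_commute)
  have between: "real (Z m) / 3 ^ k \<le> F t \<and> F t \<le> real (Z (m + 2)) / 3 ^ k"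
    if t: "0 \<le> t" "m \<le> nat \<lfloor>2 ^ k * t\<rfloor>" "nat \<lfloor>2 ^ k * t\<rfloor> \<le> m + 1" for t
  proof
    have "real (Z m) / 3 ^ k \<le> F_lower t k"
      unfolding F_lower_def by (intro divide_right_mono) (use Z_mono[OF t(2)] in simp_all)
    also have "\<dots> \<le> F t" by (rule F_lower_le_F[OF t(1)])
    finally show "real (Z m) / 3 ^ k \<le> F t" .
    have "F t \<le> F_upper t k" by (rule F_le_F_upper[OF t(1)])
    also have "\<dots> \<le> real (Z (m + 2)) / 3 ^ k"
      unfolding F_upper_def by (intro divide_right_mono of_nat_mono Z_mono) (use t(3) in simp_all)
    finally show "F t \<le> real (Z (m + 2)) / 3 ^ k" .
  qed
  have "0 \<le> y" using assms by simp
  then show ?thesis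
    using gap between[of x] between[of y] m assms(1) unfolding m_def[symmetric] m'_def[symmetric]
    by (auto simp: diff_divide_distrib abs_le_iff)
qed

lemma F_continuous: "continuous_on {0..} F"
  unfolding continuous_on_def tendsto_iff eventually_at
proof (intro ballI allI impI)
  fix x e :: real assume x: "x \<in> {0..}" and e: "e > 0"
  \<comment> \<open>One \<open>c\<close> serves both orders of \<open>x\<close> and
    \<open>y\<close>, because the left point is always at most \<open>x\<close>.\<close>
  obtain c where c: "2 * (x + 1) + 3 < 2 ^ c"
    using real_arch_pow[of 2 "2 * (x + 1) + 3"] by auto
  have "(\<lambda>k. 2 * \<phi> ^ c * (\<phi> / 3) ^ k) \<longlonglongrightarrow> 2 * \<phi> ^ c * 0"
    using phi_gt_1 phi_lt_3 by (intro tendsto_mult_left LIMSEQ_realpow_zero) auto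
  then have "\<forall>\<^sub>F k in sequentially. 2 * \<phi> ^ c * (\<phi> / 3) ^ k < e"
    using e by (simp add: order_tendstoD)
  then obtain k where k: "2 * \<phi> ^ c * (\<phi> / 3) ^ k < e"
    by (auto dest: eventually_happens)
  have one: "1 / 2 ^ k \<le> (1::real)" by simp
  show "\<exists>d>0. \<forall>y\<in>{0..}. y \<noteq> x \<and> dist y x < d \<longrightarrow> dist (F y) (F x) < e"
  proof (intro exI conjI ballI impI)
    fix y :: real assume y: "y \<in> {0..}" and "y \<noteq> x \<and> dist y x < 1 / 2 ^ k"
    then have d: "dist y x < 1 / 2 ^ k" by simp
    have "\<bar>F x - F y\<bar> \<le> 2 * \<phi> ^ c * (\<phi> / 3) ^ k"
    proof (cases "x \<le> y")
      case True
      then show ?thesis using x d c one by (intro F_modulus) (auto simp: dist_real_def)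
    next
      case False
      then have "\<bar>F y - F x\<bar> \<le> 2 * \<phi> ^ c * (\<phi> / 3) ^ k"
        using y d c one by (intro F_modulus) (auto simp: dist_real_def)
      then show ?thesis by (simp add: abs_minus_commute)
    qed
    then show "dist (F y) (F x) < e" using k by (simp add: dist_real_def abs_minus_commute)
  qed simp
qed

section \<open>The periodic function\<close>

text \<open>The factor \<open>2\<close> in the denominator normalises for \<open>Phi_D\<close>,
  since \<open>Z\<close> is twice the Stern sum up to the error term.\<close>

definition \<Phi>\<^sub>F :: "real \<Rightarrow> real" where
  "\<Phi>\<^sub>F t = F (2 powr t) / (2 * 3 powr t)"

lemma periodic_frac:
  fixes \<Phi> :: "real \<Rightarrow> 'a"
  assumes "\<And>x. \<Phi> (x + 1) = \<Phi> x"
  shows "\<Phi> (frac x) = \<Phi> x"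
proof -
  have nat: "\<Phi> (y + real n) = \<Phi> y" for y n
    by (induction n) (use assms[of "y + real _"] in \<open>simp_all add: add_ac\<close>)
  show ?thesis
  proof (cases "\<lfloor>x\<rfloor> \<ge> 0")
    case True
    then have "x = frac x + real (nat \<lfloor>x\<rfloor>)" by (simp add: frac_def)
    then show ?thesis using nat by metis
  next
    case False
    then have "frac x = x + real (nat (- \<lfloor>x\<rfloor>))" by (simp add: frac_def)
    then show ?thesis using nat by metis
  qed
qed

lemma Phi_F_periodic: "\<Phi>\<^sub>F (t + 1) = \<Phi>\<^sub>F t"
  using F_double[of "2 powr t"] by (simp add: \<Phi>\<^sub>F_def powr_add mult.commute)

lemma powr_kappa:
  assumes "0 < x"
  shows "x powr \<kappa> = 3 powr log 2 x"
  using assms by (simp add: powr_def \<kappa>_def log_def)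

text \<open>Exact because \<open>F\<close> interpolates \<open>Z\<close>: at
  \<open>t = log 2 N\<close> one has \<open>2 powr t = N\<close> and
  \<open>3 powr t = N powr \<kappa>\<close>, and periodicity removes \<open>frac\<close>.\<close>

lemma Z_eq_Phi_F:
  assumes "N \<ge> 1"
  shows "real (Z N) = real N powr \<kappa> * (2 * \<Phi>\<^sub>F (frac (log 2 (real N))))"
  using assms by (simp add: periodic_frac[of \<Phi>\<^sub>F, OF Phi_F_periodic] powr_kappa)
    (simp add: \<Phi>\<^sub>F_def F_of_nat)

lemma is_Phi_D_Phi_F: "is_Phi_D \<Phi>\<^sub>F"
  unfolding is_Phi_D_def
proof (intro conjI allI Phi_F_periodic)
  show "continuous_on UNIV \<Phi>\<^sub>F"
    unfolding \<Phi>\<^sub>F_def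
    by (intro continuous_intros continuous_on_compose2[OF F_continuous]) auto
  let ?f = "\<lambda>N::nat. real (\<Sum>n<N. stern n) - real N powr \<kappa> * \<Phi>\<^sub>F (frac (log 2 (real N)))"
  \<comment> \<open>The exact formula for \<open>Z N\<close> leaves only the boundary term, so the
    growth bound for \<open>stern\<close> finishes.\<close>
  have "?f N = - (1/2) * real (stern N)" if "N \<ge> 1" for N
    using Z_eq_Phi_F[OF that] Z_eq_sum_stern[of N] by simp
  then have "\<forall>\<^sub>F N in sequentially. ?f N = - (1/2) * real (stern N)"
    by (rule eventually_sequentiallyI)
  then have "?f \<in> O(\<lambda>N. real N powr log 2 \<phi>) \<longleftrightarrow>
      (\<lambda>N. - (1/2) * real (stern N)) \<in> O(\<lambda>N. real N powr log 2 \<phi>)"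
    by (rule landau_o.big.in_cong)
  then show "?f \<in> O(\<lambda>N. real N powr log 2 \<phi>)"
    using stern_bigo by simp
qed

text \<open>Evaluate the difference along \<open>N\<^sub>k = \<lfloor>2\<^bsup>k + x\<^esup>\<rfloor>\<close>: modulo \<open>1\<close>, its binary logarithm tends to
  \<open>x\<close>, whereas the error term relative to \<open>N\<^sub>k\<^bsup>\<kappa>\<^esup>\<close> tends to \<open>0\<close>.\<close>

lemma is_Phi_D_unique:
  assumes "is_Phi_D \<Phi>" "is_Phi_D \<Psi>"
  shows "\<Phi> = \<Psi>"
proof
  fix x :: real
  define \<Delta> where "\<Delta> t = \<Psi> t - \<Phi> t" for t
  have cont: "continuous_on UNIV \<Delta>"
    using assms unfolding is_Phi_D_def \<Delta>_def by (intro continuous_on_diff) auto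
  have per: "\<Delta> (t + 1) = \<Delta> t" for t
    using assms unfolding is_Phi_D_def \<Delta>_def by simp
  \<comment> \<open>Subtracting the two expansions cancels the common Stern sum.\<close>
  have "(\<lambda>N. real N powr \<kappa> * \<Delta> (frac (log 2 (real N)))) \<in> O(\<lambda>N. real N powr log 2 \<phi>)"
    using sum_in_bigo(2)[OF assms[unfolded is_Phi_D_def, THEN conjunct2, THEN conjunct2]]
    by (simp add: \<Delta>_def right_diff_distrib)
  then obtain C where C: "\<forall>\<^sub>F N in sequentially.
      norm (real N powr \<kappa> * \<Delta> (frac (log 2 (real N)))) \<le> C * norm (real N powr log 2 \<phi>)"
    by (elim landau_o.bigE)
  have bound: "\<forall>\<^sub>F N in sequentially. 
      norm (\<Delta> (log 2 (real N))) \<le> norm (real N powr (log 2 \<phi> - \<kappa>)) * C"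
    using C eventually_gt_at_top[of 0]
    by eventually_elim (simp add: periodic_frac[of \<Delta>, OF per] abs_mult powr_diff field_simps)
  \<comment> \<open>The error exponent lies strictly below \<open>\<kappa>\<close> because
    \<open>\<phi> < 3\<close>.\<close>
  have "log 2 \<phi> - \<kappa> < 0" using phi_gt_1 phi_lt_3 by (simp add: \<kappa>_def)
  then have "(\<lambda>N. real N powr (log 2 \<phi> - \<kappa>)) \<longlonglongrightarrow> 0"
    by (intro tendsto_neg_powr filterlim_real_sequentially)
  then have lim0: "(\<lambda>N. \<Delta> (log 2 (real N))) \<longlonglongrightarrow> 0"
    using bound by (rule tendsto_0_le)
  define N where "N k = nat \<lfloor>2 ^ k * 2 powr x\<rfloor>" for k
  have half: "filterlim (\<lambda>k. 2 ^ k * 2 powr x) at_top sequentially"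
    by (rule filterlim_at_top_mult_tendsto_pos[OF tendsto_const _
          filterlim_at_top_mono[OF filterlim_real_sequentially]])
      (auto intro: less_imp_le of_nat_less_two_power)
  have N_top: "filterlim N at_top sequentially"
    unfolding N_def
    by (rule filterlim_compose[OF filterlim_nat_sequentially filterlim_compose[OF filterlim_floor_sequentially half]])
  have "(\<lambda>k. real (N k) / 2 ^ k) \<longlonglongrightarrow> 2 powr x"
  proof (rule tendsto_sandwich)
    show "(\<lambda>k. 2 powr x - (1/2) ^ k) \<longlonglongrightarrow> 2 powr x"
      using tendsto_diff[OF tendsto_const LIMSEQ_realpow_zero[of "1/2"]] by simp
    have N: "2 ^ k * 2 powr x - 1 \<le> real (N k)" "real (N k) \<le> 2 ^ k * 2 powr x" for k
      unfolding N_def using zero_le_mult_iff[of "2 ^ k" "2 powr x"] by (auto simp: of_nat_floor)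
    have "2 powr x - (1/2) ^ k = (2 ^ k * 2 powr x - 1) / 2 ^ k" for k
      by (simp add: diff_divide_distrib power_one_over)
    then show "\<forall>\<^sub>F k in sequentially. 2 powr x - (1/2) ^ k \<le> real (N k) / 2 ^ k"
      by (intro always_eventually allI) (simp only:, intro divide_right_mono N, simp)
    show "\<forall>\<^sub>F k in sequentially. real (N k) / 2 ^ k \<le> 2 powr x"
      using N(2) by (intro always_eventually allI) (simp add: divide_le_eq mult.commute)
  qed auto
  then have "(\<lambda>k. log 2 (real (N k) / 2 ^ k)) \<longlonglongrightarrow> log 2 (2 powr x)"
    by (intro tendsto_log) auto
  then have "(\<lambda>k. \<Delta> (log 2 (real (N k) / 2 ^ k))) \<longlonglongrightarrow> \<Delta> x"
    using cont by (auto simp: continuous_on_eq_continuous_at intro: isCont_tendsto_compose)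
  \<comment> \<open>Once \<open>N k > 0\<close>, the two arguments differ by the integer
    \<open>k\<close>, which periodicity ignores.\<close>
  moreover have "\<forall>\<^sub>F k in sequentially. \<Delta> (log 2 (real (N k) / 2 ^ k)) = \<Delta> (log 2 (real (N k)))"
  proof -
    have "\<forall>\<^sub>F k in sequentially. N k > 0" 
      using N_top eventually_gt_at_top by (rule eventually_compose_filterlim[rotated])
    then show ?thesis
    proof eventually_elim
      case (elim k)
      have "frac (log 2 (real (N k) / 2 ^ k)) = frac (log 2 (real (N k)))"
        using elim floor_diff_of_int[of "log 2 (real (N k))" "int k"]
        by (simp add: log_divide log_nat_power frac_def)
      then show ?case using periodic_frac[of \<Delta>, OF per] by metis
    qed
  qed
  ultimately have "(\<lambda>k. \<Delta> (log 2 (real (N k)))) \<longlonglongrightarrow> \<Delta> x"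
    by (rule Lim_transform_eventually)
  then have "\<Delta> x = 0"
    using LIMSEQ_unique filterlim_compose[OF lim0 N_top] by blast
  then show "\<Phi> x = \<Psi> x" by (simp add: \<Delta>_def)
qed

text \<open>\<open>Phi_D\<close> is a definite description, so unique existence is what identifies
  it with \<open>\<Phi>\<^sub>F\<close> and transfers the exact formula.\<close>

theorem theorem6p4:
  "(\<exists>!\<Phi>. is_Phi_D \<Phi>) \<and>
   (\<forall>N::nat. N \<ge> 1 \<longrightarrow> real (Z N) = real N powr \<kappa> * Phi_Z (frac (log 2 (real N))))"
proof
  show ex1: "\<exists>!\<Phi>. is_Phi_D \<Phi>"
    using is_Phi_D_Phi_F is_Phi_D_unique by blast
  have "Phi_D = \<Phi>\<^sub>F"
    unfolding Phi_D_def by (rule the1_equality[where P = is_Phi_D]) (rule ex1, rule is_Phi_D_Phi_F)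
  then show "\<forall>N::nat. N \<ge> 1 \<longrightarrow> real (Z N) = real N powr \<kappa> * Phi_Z (frac (log 2 (real N)))"
    using Z_eq_Phi_F by (simp add: Phi_Z_def)
qed

end
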